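(* Let $G\colon\mathbb{A}^n_{\mathbf w}\to\mathbb{A}^n_{\mathbf q}$ be a graded Keller map over $\mathbb{C}$ with elliptic source weights $\mathbf w$. Then $G$ is an isomorphism of graded affine spaces: it is bijective, its inverse is polynomial, and $G^{-1}\colon\mathbb{A}^n_{\mathbf q}\to\mathbb{A}^n_{\mathbf w}$ is graded. In particular, forgetting the gradings, $G$ is a polynomial automorphism of $\mathbb{A}^n$.
   Context: A weight vector is $\mathbf w=(w_1,\dots,w_n)\in\mathbb{Z}^n$; it grades $\mathbb{C}[x_1,\dots,x_n]$ by giving the monomial $x_1^{m_1}\cdots x_n^{m_n}$ weight $\sum_i m_iw_i$. A polynomial is weight-homogeneous of weight $\ell$ if all its monomials have weight $\ell$ (the zero polynomial is weight-homogeneous of every weight). $\mathbb{A}^n_{\mathbf w}$ denotes affine space over $\mathbb{C}$ with this grading of its coordinate ring. For $\mathbf w,\mathbf q\in\mathbb{Z}^n$, a polynomial map $G=(G_1,\dots,G_n)\colon\mathbb{A}^n_{\mathbf w}\to\mathbb{A}^n_{\mathbf q}$ is graded if each component $G_j$ is weight-homogeneous of weight $q_j$ for the grading $\mathbf w$; equivalently $G(t^{w_1}x_1,\dots,t^{w_n}x_n)=(t^{q_1}G_1(x),\dots,t^{q_n}G_n(x))$ for all $t\in\mathbb{C}^\times$. The weight vector $\mathbf w$ is elliptic if all $w_i$ are nonzero and of the same sign. A Keller map is a polynomial map $\mathbb{C}^n\to\mathbb{C}^n$ whose Jacobian determinant is a nonzero constant; a graded Keller map is a Keller map that is graded for the given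 weight vectors. A polynomial automorphism is a bijective polynomial map with polynomial inverse. *)

theory Defs
  imports "HOL-Analysis.Analysis" "HOL-Library.Poly_Mapping"
begin

text \<open>
  The coordinate ring of affine space: exponent vectors are finitely supported maps to the
  naturals, polynomials are finitely supported maps from exponent vectors to coefficients. The
  variables are indexed by a finite type, so $n$ is the cardinality of that type.
\<close>

type_synonym 'n cpoly = "('n \<Rightarrow>\<^sub>0 nat) \<Rightarrow>\<^sub>0 complex"

definition poly_eval :: "'n::finite cpoly \<Rightarrow> complex ^ 'n \<Rightarrow> complex" where
  "poly_eval p x =
     (\<Sum>m\<in>Poly_Mapping.keys p.
        Poly_Mapping.lookup p m * (\<Prod>i\<in>UNIV. x $ i ^ Poly_Mapping.lookup m i))"

text \<open>
  Formal partial derivative. The subtraction of exponent vectors truncates only where the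
  exponent of the variable is zero, and there the coefficient vanishes.
\<close>

definition pderiv_var :: "'n::finite \<Rightarrow> 'n cpoly \<Rightarrow> 'n cpoly" where
  "pderiv_var i p =
     (\<Sum>m\<in>Poly_Mapping.keys p.
        Poly_Mapping.single (m - Poly_Mapping.single i 1)
          (of_nat (Poly_Mapping.lookup m i) * Poly_Mapping.lookup p m))"

text \<open>
  A polynomial self-map of affine $n$-space is given by its tuple of component polynomials;
  \<open>poly_map\<close> is the induced map on points. Over the complex numbers the tuple is determined
  by the induced map.
\<close>

definition poly_map :: "('n::finite cpoly) ^ 'n \<Rightarrow> complex ^ 'n \<Rightarrow> complex ^ 'n" where
  "poly_map G x = (\<chi> j. poly_eval (G $ j) x)"

definition is_polynomial_map :: "(complex ^ 'n::finite \<Rightarrow> complex ^ 'n) \<Rightarrow> bool" where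
  "is_polynomial_map F \<longleftrightarrow> (\<exists>G. F = poly_map G)"

definition polynomial_automorphism :: "(complex ^ 'n::finite \<Rightarrow> complex ^ 'n) \<Rightarrow> bool" where
  "polynomial_automorphism F \<longleftrightarrow> is_polynomial_map F \<and> bij F \<and> is_polynomial_map (inv F)"

definition jacobian_det :: "('n::finite cpoly) ^ 'n \<Rightarrow> 'n cpoly" where
  "jacobian_det G = det (\<chi> j i. pderiv_var i (G $ j))"

definition keller_map :: "('n::finite cpoly) ^ 'n \<Rightarrow> bool" where
  "keller_map G \<longleftrightarrow> (\<exists>c. c \<noteq> 0 \<and> jacobian_det G = Poly_Mapping.single 0 c)"

definition monomial_weight :: "int ^ 'n::finite \<Rightarrow> ('n \<Rightarrow>\<^sub>0 nat) \<Rightarrow> int" where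
  "monomial_weight w m = (\<Sum>i\<in>UNIV. int (Poly_Mapping.lookup m i) * w $ i)"

definition weight_homogeneous :: "int ^ 'n::finite \<Rightarrow> int \<Rightarrow> 'n cpoly \<Rightarrow> bool" where
  "weight_homogeneous w l p \<longleftrightarrow> (\<forall>m\<in>Poly_Mapping.keys p. monomial_weight w m = l)"

definition graded_map :: "int ^ 'n::finite \<Rightarrow> int ^ 'n \<Rightarrow> ('n cpoly) ^ 'n \<Rightarrow> bool" where
  "graded_map w q G \<longleftrightarrow> (\<forall>j. weight_homogeneous w (q $ j) (G $ j))"

definition elliptic :: "int ^ 'n::finite \<Rightarrow> bool" where
  "elliptic w \<longleftrightarrow> (\<forall>i. w $ i \<noteq> 0) \<and> (\<forall>i j. sgn (w $ i) = sgn (w $ j))"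

end

theory Submission imports Defs begin

text \<open>
  Let \<open>A\<close> be the Jacobian matrix of \<open>G\<close> at the origin. It is invertible because its determinant is
  the value of the constant Jacobian determinant, and \<open>y = G x\<close> is equivalent to \<open>x\<close> being a fixed
  point of the chord Newton step \<open>x \<mapsto> x + B (y - G x)\<close> for any invertible matrix \<open>B\<close>; take
  \<open>B = A\<inverse>\<close>. Ellipticity makes this step nilpotent. If \<open>B\<^sub>i\<^sub>j \<noteq> 0\<close> then \<open>G\<^sub>j\<close> has
  weight \<open>w\<^sub>i\<close>, and since all weights have the same sign, a monomial of weight \<open>w\<^sub>i\<close> other than a
  single variable involves only variables \<open>x\<^sub>k\<close> with \<open>\<bar>w\<^sub>k\<bar> < \<bar>w\<^sub>i\<bar>\<close>. The linear parts
  cancel, so coordinate \<open>i\<close> of the step depends only on coordinates of strictly smaller absolute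
  weight (\<open>chord_step_gains_a_weight\<close>). After \<open>N \<ge> max \<bar>w\<^sub>i\<bar>\<close> steps the starting point
  is forgotten, so the \<open>N\<close>-th iterate started at \<open>0\<close> is the one and only fixed point, that is,
  the one and only preimage of \<open>y\<close>.

  This iterate is a polynomial in \<open>y\<close>. It is graded because each step preserves the property that
  coordinate \<open>i\<close> of the current point is weight-homogeneous of weight \<open>w\<^sub>i\<close> in \<open>y\<close>, and the zero
  starting point has this property trivially.
\<close>

section \<open>Evaluation of polynomials\<close>

lemma poly_eval_superset:
  assumes "finite S" and "Poly_Mapping.keys p \<subseteq> S"
  shows "poly_eval p x =
    (\<Sum>m\<in>S. Poly_Mapping.lookup p m * (\<Prod>i\<in>UNIV. x $ i ^ Poly_Mapping.lookup m i))"
  unfolding poly_eval_def using assms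
  by (intro sum.mono_neutral_left) (auto simp: in_keys_iff)

lemma poly_eval_zero [simp]: "poly_eval 0 x = 0"
  by (simp add: poly_eval_def)

lemma poly_eval_single:
  "poly_eval (Poly_Mapping.single m c) x = c * (\<Prod>i\<in>UNIV. x $ i ^ Poly_Mapping.lookup m i)"
  by (subst poly_eval_superset[of "{m}"]) (auto simp: lookup_single)

lemma poly_eval_one [simp]: "poly_eval 1 x = 1"
  unfolding single_one[symmetric] poly_eval_single by simp

lemma poly_eval_add: "poly_eval (p + r) x = poly_eval p x + poly_eval r x"
proof -
  let ?S = "Poly_Mapping.keys p \<union> Poly_Mapping.keys r"
  have "Poly_Mapping.keys (p + r) \<subseteq> ?S"
    by (rule keys_add)
  then show ?thesis
    by (simp add: poly_eval_superset[of ?S] lookup_add sum.distrib distrib_right)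
qed

lemma poly_eval_sum: "poly_eval (\<Sum>a\<in>S. f a) x = (\<Sum>a\<in>S. poly_eval (f a) x)"
  by (induction S rule: infinite_finite_induct) (auto simp: poly_eval_add)

lemma sum_of_monomials:
  "(\<Sum>m\<in>Poly_Mapping.keys p. Poly_Mapping.single m (Poly_Mapping.lookup p m)) = p"
proof (rule poly_mapping_eqI)
  fix k
  show "Poly_Mapping.lookup
      (\<Sum>m\<in>Poly_Mapping.keys p. Poly_Mapping.single m (Poly_Mapping.lookup p m)) k
    = Poly_Mapping.lookup p k"
    by (auto simp: lookup_sum lookup_single when_def in_keys_iff)
qed

lemma poly_eval_mult: "poly_eval (p * r) x = poly_eval p x * poly_eval r x"
proof -
  have single: "poly_eval (Poly_Mapping.single m c * Poly_Mapping.single k d) x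
    = poly_eval (Poly_Mapping.single m c) x * poly_eval (Poly_Mapping.single k d) x" for m k c d
    by (simp add: mult_single poly_eval_single lookup_add power_add prod.distrib)
  let ?P = "\<lambda>p :: 'a cpoly.
    \<Sum>m\<in>Poly_Mapping.keys p. Poly_Mapping.single m (Poly_Mapping.lookup p m)"
  have "poly_eval (?P p * ?P r) x = poly_eval (?P p) x * poly_eval (?P r) x"
    by (simp add: sum_product poly_eval_sum single)
  then show ?thesis
    by (simp only: sum_of_monomials)
qed

lemma poly_eval_prod: "poly_eval (\<Prod>a\<in>S. f a) x = (\<Prod>a\<in>S. poly_eval (f a) x)"
  by (induction S rule: infinite_finite_induct) (auto simp: poly_eval_mult)

lemma poly_eval_of_int: "poly_eval (of_int k) x = of_int k"
  unfolding single_of_int[symmetric] poly_eval_single by simp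

lemma poly_eval_det: "poly_eval (det A) x = det (\<chi> j i. poly_eval (A $ j $ i) x)"
  by (simp add: det_def poly_eval_sum poly_eval_mult poly_eval_of_int poly_eval_prod)

lemma poly_eval_at_zero: "poly_eval p 0 = Poly_Mapping.lookup p 0"
proof -
  have const: "(\<Prod>i\<in>UNIV. (0 :: complex ^ 'a) $ i ^ Poly_Mapping.lookup m i) = (1 when m = 0)"
    for m :: "'a \<Rightarrow>\<^sub>0 nat"
    by (auto simp: when_def poly_mapping_eq_iff fun_eq_iff)
  show ?thesis
    unfolding poly_eval_def const
    by (auto simp: when_def in_keys_iff if_distrib cong: if_cong)
qed

section \<open>The linear part\<close>

definition linear_part :: "('n::finite cpoly) ^ 'n \<Rightarrow> complex ^ 'n ^ 'n" where
  "linear_part G = (\<chi> j i. Poly_Mapping.lookup (G $ j) (Poly_Mapping.single i 1))"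

lemma pderiv_var_at_zero:
  "poly_eval (pderiv_var i p) 0 = Poly_Mapping.lookup p (Poly_Mapping.single i 1)"
proof -
  have only_variable: "m = Poly_Mapping.single i 1"
    if "m - Poly_Mapping.single i 1 = 0" and "Poly_Mapping.lookup m i \<noteq> 0"
    for m :: "'a \<Rightarrow>\<^sub>0 nat"
  proof (rule poly_mapping_eqI)
    fix k
    have "Poly_Mapping.lookup (m - Poly_Mapping.single i 1) k = 0"
      using that by simp
    then show "Poly_Mapping.lookup m k = Poly_Mapping.lookup (Poly_Mapping.single i 1) k"
      using that(2) by (cases "k = i") (auto simp: lookup_minus lookup_single)
  qed
  have "poly_eval (pderiv_var i p) 0 = (\<Sum>m\<in>Poly_Mapping.keys p.
      of_nat (Poly_Mapping.lookup m i) * Poly_Mapping.lookup p m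
        when m - Poly_Mapping.single i 1 = 0)"
    by (simp add: pderiv_var_def poly_eval_at_zero lookup_sum lookup_single)
  also have "\<dots> = (\<Sum>m\<in>Poly_Mapping.keys p.
      if m = Poly_Mapping.single i 1 then Poly_Mapping.lookup p m else 0)"
    by (intro sum.cong refl) (use only_variable in \<open>force simp: when_def\<close>)
  also have "\<dots> = Poly_Mapping.lookup p (Poly_Mapping.single i 1)"
    by (auto simp: in_keys_iff)
  finally show ?thesis .
qed

lemma invertible_linear_part:
  assumes "keller_map G"
  shows "invertible (linear_part G)"
proof -
  obtain c where c: "c \<noteq> 0" "jacobian_det G = Poly_Mapping.single 0 c"
    using assms by (auto simp: keller_map_def)
  have "det (linear_part G) = poly_eval (jacobian_det G) 0"
    by (simp add: jacobian_det_def poly_eval_det pderiv_var_at_zero linear_part_def)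
  also have "\<dots> = c"
    by (simp add: c poly_eval_at_zero)
  finally show ?thesis
    using c(1) by (simp add: invertible_det_nz)
qed

text \<open>
  The linear part of a graded map is block diagonal with respect to the weights, since \<open>x\<^sub>i\<close> can
  occur in \<open>G\<^sub>j\<close> only if \<open>w\<^sub>i = q\<^sub>j\<close>. Its inverse inherits the blocks: the off-block entries of an
  arbitrary inverse can be set to zero without disturbing the identity \<open>B A = 1\<close>, block by block.
\<close>

lemma graded_inverse_of_linear_part:
  assumes graded: "graded_map w q G" and inv: "invertible (linear_part G)"
  obtains B where "B ** linear_part G = mat 1" and "linear_part G ** B = mat 1"
    and "\<And>i j. B $ i $ j \<noteq> 0 \<Longrightarrow> q $ j = w $ i"
proof -
  let ?A = "linear_part G"
  obtain C where C: "C ** ?A = mat 1"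
    using inv by (auto simp: invertible_left_inverse)
  define B where "B = (\<chi> i j. if q $ j = w $ i then C $ i $ j else 0)"
  have block: "q $ j = w $ k" if "?A $ j $ k \<noteq> 0" for j k
  proof -
    have "Poly_Mapping.single k 1 \<in> Poly_Mapping.keys (G $ j)"
      using that by (simp add: linear_part_def in_keys_iff)
    then have "monomial_weight w (Poly_Mapping.single k 1) = q $ j"
      using graded by (auto simp: graded_map_def weight_homogeneous_def)
    moreover have "monomial_weight w (Poly_Mapping.single k 1) = w $ k"
      by (simp add: monomial_weight_def lookup_single when_def if_distrib[of int]
          if_distrib[of "\<lambda>a. a * _"] cong: if_cong)
    ultimately show ?thesis by simp
  qed
  have "(B ** ?A) $ i $ k = (if w $ k = w $ i then (C ** ?A) $ i $ k else 0)" for i k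
  proof -
    have "B $ i $ j * ?A $ j $ k = (if w $ k = w $ i then C $ i $ j * ?A $ j $ k else 0)" for j
      using block[of j k] by (cases "?A $ j $ k = 0") (auto simp: B_def)
    then show ?thesis
      by (simp add: matrix_matrix_mult_def)
  qed
  then have left: "B ** ?A = mat 1"
    by (auto simp: vec_eq_iff C mat_def)
  then have right: "?A ** B = mat 1"
    by (simp add: matrix_left_right_inverse)
  have "q $ j = w $ i" if "B $ i $ j \<noteq> 0" for i j
    using that by (auto simp: B_def split: if_splits)
  with left right show ?thesis
    by (rule that)
qed

section \<open>The chord Newton step forgets its starting point\<close>

text \<open>
  With elliptic weights nothing cancels in the weight of a monomial, so every variable that occurs
  in it contributes at most the total, and contributes all of it only if there is nothing else.
\<close>

lemma elliptic_weight_of_factor: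
  assumes ell: "elliptic w" and occurs: "Poly_Mapping.lookup m k \<noteq> 0"
    and not_variable: "m \<noteq> Poly_Mapping.single k 1"
  shows "\<bar>w $ k\<bar> < \<bar>monomial_weight w m\<bar>"
proof -
  let ?e = "Poly_Mapping.lookup m"
  have nonzero: "\<bar>w $ i\<bar> > 0" for i
    using ell by (auto simp: elliptic_def)
  have signed: "w $ i = sgn (w $ k) * \<bar>w $ i\<bar>" for i
    using ell by (metis elliptic_def sgn_mult_abs)
  have "monomial_weight w m = sgn (w $ k) * (\<Sum>i\<in>UNIV. int (?e i) * \<bar>w $ i\<bar>)"
    unfolding monomial_weight_def sum_distrib_left
    by (intro sum.cong refl, subst signed) (rule mult.left_commute)
  moreover have "\<bar>sgn (w $ k)\<bar> = 1"
    using nonzero[of k] by (simp add: abs_sgn_eq)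
  ultimately have total: "\<bar>monomial_weight w m\<bar> = (\<Sum>i\<in>UNIV. int (?e i) * \<bar>w $ i\<bar>)"
    by (simp add: abs_mult sum_nonneg)
  also have "\<dots> = int (?e k) * \<bar>w $ k\<bar> + (\<Sum>i\<in>UNIV - {k}. int (?e i) * \<bar>w $ i\<bar>)"
    by (rule sum.remove) auto
  finally have split: "\<bar>monomial_weight w m\<bar> = \<dots>" .
  have rest: "0 \<le> (\<Sum>i\<in>UNIV - {k}. int (?e i) * \<bar>w $ i\<bar>)"
    by (intro sum_nonneg) auto
  show ?thesis
  proof (cases "?e k = 1")
    case True
    obtain i where i: "?e i \<noteq> Poly_Mapping.lookup (Poly_Mapping.single k 1) i"
      using not_variable by (auto simp: poly_mapping_eq_iff fun_eq_iff)
    then have "i \<noteq> k" "?e i \<noteq> 0"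
      using True by (auto simp: lookup_single when_def split: if_splits)
    then have "0 < (\<Sum>i\<in>UNIV - {k}. int (?e i) * \<bar>w $ i\<bar>)"
      using nonzero[of i] by (intro sum_pos2[of _ i]) auto
    then show ?thesis
      using split True by simp
  next
    case False
    then have "1 * \<bar>w $ k\<bar> < int (?e k) * \<bar>w $ k\<bar>"
      using occurs nonzero[of k] by (intro mult_strict_right_mono) auto
    then show ?thesis
      using split rest by linarith
  qed
qed

lemma nonlinear_part_depends_on_smaller_weights:
  assumes ell: "elliptic w" and hom: "weight_homogeneous w l p"
    and agree: "\<And>k. \<bar>w $ k\<bar> < \<bar>l\<bar> \<Longrightarrow> x $ k = x' $ k"
  defines "lin \<equiv> \<lambda>z :: complex ^ 'n::finite.
    \<Sum>i\<in>UNIV. Poly_Mapping.lookup p (Poly_Mapping.single i 1) * z $ i"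
  shows "poly_eval p x - lin x = poly_eval p x' - lin x'"
proof -
  define V :: "('n \<Rightarrow>\<^sub>0 nat) set" where "V = range (\<lambda>i. Poly_Mapping.single i 1)"
  define t where "t = (\<lambda>(z :: complex ^ 'n) m.
    Poly_Mapping.lookup p m * (\<Prod>i\<in>UNIV. z $ i ^ Poly_Mapping.lookup m i))"
  have inj: "inj (\<lambda>i :: 'n. Poly_Mapping.single i (1 :: nat))"
    by (rule injI) (metis lookup_single_eq lookup_single_not_eq zero_neq_one)
  have nonlinear: "poly_eval p z - lin z = (\<Sum>m\<in>Poly_Mapping.keys p - V. t z m)" for z
  proof -
    have "(\<Prod>j\<in>UNIV. z $ j ^ Poly_Mapping.lookup (Poly_Mapping.single i 1) j) = z $ i" for i
      by (simp add: lookup_single when_def if_distrib[of "\<lambda>e. _ ^ e"] cong: if_cong)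
    then have "lin z = sum (t z) V"
      by (simp only: lin_def V_def t_def sum.reindex[OF inj] o_def)
    moreover have "poly_eval p z = sum (t z) (Poly_Mapping.keys p \<union> V)"
      unfolding t_def by (rule poly_eval_superset) (auto simp: V_def)
    moreover have "sum (t z) (Poly_Mapping.keys p \<union> V)
        = sum (t z) (Poly_Mapping.keys p - V) + sum (t z) V"
      by (subst sum.union_disjoint[symmetric]) (auto simp: V_def)
    ultimately show ?thesis by simp
  qed
  have "t x m = t x' m" if m: "m \<in> Poly_Mapping.keys p - V" for m
  proof -
    have "x $ i ^ Poly_Mapping.lookup m i = x' $ i ^ Poly_Mapping.lookup m i" for i
    proof (cases "Poly_Mapping.lookup m i = 0")
      case False
      moreover have "m \<noteq> Poly_Mapping.single i 1"
        using m by (auto simp: V_def)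
      ultimately have "\<bar>w $ i\<bar> < \<bar>monomial_weight w m\<bar>"
        by (rule elliptic_weight_of_factor[OF ell])
      then show ?thesis
        using agree[of i] hom m by (simp add: weight_homogeneous_def)
    qed simp
    then show ?thesis
      by (simp add: t_def)
  qed
  then show ?thesis
    by (simp add: nonlinear)
qed

definition chord_step ::
  "complex ^ 'n ^ 'n \<Rightarrow> ('n::finite cpoly) ^ 'n \<Rightarrow> complex ^ 'n \<Rightarrow> complex ^ 'n \<Rightarrow> complex ^ 'n"
  where "chord_step B G y x = x + B *v (y - poly_map G x)"

lemma chord_step_component:
  "chord_step B G y x $ i = x $ i + (\<Sum>j\<in>UNIV. B $ i $ j * (y $ j - poly_eval (G $ j) x))"
  by (simp add: chord_step_def matrix_vector_mult_def poly_map_def)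

lemma chord_step_fixed_point_iff:
  assumes "A ** B = mat 1"
  shows "chord_step B G y x = x \<longleftrightarrow> poly_map G x = y"
proof -
  have "B *v v = 0 \<longleftrightarrow> v = 0" for v
    by (metis assms matrix_vector_mul_assoc matrix_vector_mul_lid matrix_vector_mult_0_right)
  then show ?thesis
    by (auto simp: chord_step_def)
qed

text \<open>
  In coordinate \<open>i\<close> the terms \<open>x\<^sub>i\<close> and \<open>B A x\<close> cancel, and what remains is built from the
  nonlinear parts of those \<open>G\<^sub>j\<close> that have weight \<open>w\<^sub>i\<close>.
\<close>

lemma chord_step_gains_a_weight:
  assumes ell: "elliptic w" and graded: "graded_map w q G"
    and left: "B ** linear_part G = mat 1"
    and block: "\<And>i j. B $ i $ j \<noteq> 0 \<Longrightarrow> q $ j = w $ i"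
    and agree: "\<And>k. \<bar>w $ k\<bar> < \<bar>w $ i\<bar> \<Longrightarrow> x $ k = x' $ k"
  shows "chord_step B G y x $ i = chord_step B G y x' $ i"
proof -
  let ?A = "linear_part G"
  have remainder: "chord_step B G y z $ i
    = (\<Sum>j\<in>UNIV. B $ i $ j * (y $ j - (poly_eval (G $ j) z - (?A *v z) $ j)))" for z
  proof -
    have "(\<Sum>j\<in>UNIV. B $ i $ j * (?A *v z) $ j) = (B *v (?A *v z)) $ i"
      by (simp add: matrix_vector_mult_def)
    also have "\<dots> = z $ i"
      by (simp add: matrix_vector_mul_assoc left)
    finally show ?thesis
      by (simp add: chord_step_component algebra_simps sum.distrib sum_subtractf)
  qed
  have "B $ i $ j * (y $ j - (poly_eval (G $ j) x - (?A *v x) $ j))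
    = B $ i $ j * (y $ j - (poly_eval (G $ j) x' - (?A *v x') $ j))" for j
  proof (cases "B $ i $ j = 0")
    case False
    then have "weight_homogeneous w (w $ i) (G $ j)"
      using graded block by (metis graded_map_def)
    from nonlinear_part_depends_on_smaller_weights[OF ell this agree] show ?thesis
      by (simp add: matrix_vector_mult_def linear_part_def)
  qed simp
  then show ?thesis
    by (simp only: remainder)
qed

text \<open>
  Each step settles the coordinates of the next absolute weight. Nothing needs to be settled at the
  start, because no coordinate has weight zero.
\<close>

lemma chord_iterate_forgets_start:
  assumes ell: "elliptic w" and graded: "graded_map w q G"
    and left: "B ** linear_part G = mat 1"
    and block: "\<And>i j. B $ i $ j \<noteq> 0 \<Longrightarrow> q $ j = w $ i"
    and "\<bar>w $ i\<bar> \<le> int N"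
  shows "(chord_step B G y ^^ N) x $ i = (chord_step B G y ^^ N) x' $ i"
  using assms(5)
proof (induction N arbitrary: i)
  case 0
  then show ?case
    using ell by (auto simp: elliptic_def)
next
  case (Suc N)
  have "(chord_step B G y ^^ N) x $ k = (chord_step B G y ^^ N) x' $ k"
    if "\<bar>w $ k\<bar> < \<bar>w $ i\<bar>" for k
    using Suc that by auto
  then show ?case
    unfolding funpow.simps o_apply
    by (intro chord_step_gains_a_weight[OF ell graded left block])
qed

text \<open>
  The value \<open>z\<close> of a constant iterate \<open>f\<^sup>N\<close> satisfies \<open>f z = f\<^sup>N (f a) = z\<close>, and every
  fixed point is its own \<open>N\<close>-th iterate, hence equal to \<open>z\<close>.
\<close>

lemma fixed_point_iff_of_constant_iterate:
  assumes const: "\<And>x x'. (f ^^ N) x = (f ^^ N) x'"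
  shows "f x = x \<longleftrightarrow> x = (f ^^ N) a"
proof
  assume "f x = x"
  then have "(f ^^ N) x = x"
    by (induction N) auto
  then show "x = (f ^^ N) a"
    using const by metis
next
  assume "x = (f ^^ N) a"
  then have "f x = (f ^^ N) (f a)"
    by (metis funpow_swap1)
  then show "f x = x"
    using const \<open>x = (f ^^ N) a\<close> by metis
qed

section \<open>Weight-homogeneous polynomial functions\<close>

text \<open>
  Tracking functions instead of formal polynomials makes substitution into a polynomial mere
  composition.
\<close>

definition homogeneous_function ::
  "int ^ 'n::finite \<Rightarrow> int \<Rightarrow> (complex ^ 'n \<Rightarrow> complex) \<Rightarrow> bool" where
  "homogeneous_function w l f \<longleftrightarrow> (\<exists>p. weight_homogeneous w l p \<and> f = poly_eval p)"

lemma homogeneous_function_zero: "homogeneous_function w l (\<lambda>_. 0)"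
  unfolding homogeneous_function_def
  by (intro exI[of _ 0]) (auto simp: weight_homogeneous_def)

lemma homogeneous_function_const: "homogeneous_function w 0 (\<lambda>_. c)"
  unfolding homogeneous_function_def
  by (intro exI[of _ "Poly_Mapping.single 0 c"])
    (auto simp: weight_homogeneous_def monomial_weight_def poly_eval_single)

lemma homogeneous_function_coordinate: "homogeneous_function w (w $ i) (\<lambda>x. x $ i)"
  unfolding homogeneous_function_def
  by (intro exI[of _ "Poly_Mapping.single (Poly_Mapping.single i 1) 1"])
    (auto simp: weight_homogeneous_def monomial_weight_def poly_eval_single fun_eq_iff
      lookup_single when_def if_distrib[of int] if_distrib[of "\<lambda>a. a * _"]
      if_distrib[of "\<lambda>e. _ ^ e"] cong: if_cong)

lemma homogeneous_function_add:
  assumes "homogeneous_function w l f" and "homogeneous_function w l g"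
  shows "homogeneous_function w l (\<lambda>x. f x + g x)"
proof -
  obtain p r where "weight_homogeneous w l p" "f = poly_eval p"
      "weight_homogeneous w l r" "g = poly_eval r"
    using assms by (auto simp: homogeneous_function_def)
  then show ?thesis
    unfolding homogeneous_function_def using keys_add[of p r]
    by (intro exI[of _ "p + r"]) (auto simp: weight_homogeneous_def poly_eval_add)
qed

lemma homogeneous_function_mult:
  assumes "homogeneous_function w l f" and "homogeneous_function w k g"
  shows "homogeneous_function w (l + k) (\<lambda>x. f x * g x)"
proof -
  obtain p r where p: "weight_homogeneous w l p" "f = poly_eval p"
      and r: "weight_homogeneous w k r" "g = poly_eval r"
    using assms by (auto simp: homogeneous_function_def)
  have "monomial_weight w (a + b) = monomial_weight w a + monomial_weight w b" for a b
    by (simp add: monomial_weight_def lookup_add distrib_right sum.distrib)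
  then have "weight_homogeneous w (l + k) (p * r)"
    using p(1) r(1) keys_mult[of p r] by (fastforce simp: weight_homogeneous_def)
  then show ?thesis
    unfolding homogeneous_function_def
    by (intro exI[of _ "p * r"]) (auto simp: p r poly_eval_mult)
qed

lemma homogeneous_function_cmult:
  assumes "homogeneous_function w l f"
  shows "homogeneous_function w l (\<lambda>x. c * f x)"
  using homogeneous_function_mult[OF homogeneous_function_const assms] by simp

lemma homogeneous_function_diff:
  assumes "homogeneous_function w l f" and "homogeneous_function w l g"
  shows "homogeneous_function w l (\<lambda>x. f x - g x)"
  using homogeneous_function_add[OF assms(1) homogeneous_function_cmult[OF assms(2), of "- 1"]]
  by simp

lemma homogeneous_function_sum:
  assumes "\<And>a. a \<in> S \<Longrightarrow> homogeneous_function w l (f a)"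
  shows "homogeneous_function w l (\<lambda>x. \<Sum>a\<in>S. f a x)"
  using assms
  by (induction S rule: infinite_finite_induct)
    (auto intro: homogeneous_function_zero homogeneous_function_add)

lemma homogeneous_function_power:
  assumes "homogeneous_function w l f"
  shows "homogeneous_function w (int e * l) (\<lambda>x. f x ^ e)"
proof (induction e)
  case 0
  show ?case
    using homogeneous_function_const[of w 1] by simp
next
  case (Suc e)
  show ?case
    using homogeneous_function_mult[OF assms Suc] by (simp add: algebra_simps)
qed

lemma homogeneous_function_prod:
  assumes "finite S" and "\<And>a. a \<in> S \<Longrightarrow> homogeneous_function w (l a) (f a)"
  shows "homogeneous_function w (\<Sum>a\<in>S. l a) (\<lambda>x. \<Prod>a\<in>S. f a x)"
  using assms
  by (induction S rule: finite_induct)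
    (auto intro: homogeneous_function_const homogeneous_function_mult)

lemma homogeneous_function_compose:
  assumes hom: "weight_homogeneous w l p"
    and h: "\<And>i. homogeneous_function q (w $ i) (\<lambda>y. h y $ i)"
  shows "homogeneous_function q l (\<lambda>y. poly_eval p (h y))"
  unfolding poly_eval_def
proof (intro homogeneous_function_sum homogeneous_function_cmult)
  fix m
  assume "m \<in> Poly_Mapping.keys p"
  then have "l = (\<Sum>i\<in>UNIV. int (Poly_Mapping.lookup m i) * w $ i)"
    using hom by (simp add: weight_homogeneous_def monomial_weight_def)
  then show "homogeneous_function q l (\<lambda>y. \<Prod>i\<in>UNIV. h y $ i ^ Poly_Mapping.lookup m i)"
    by (simp add: homogeneous_function_prod homogeneous_function_power h)
qed

text \<open>
  A nonzero entry \<open>B\<^sub>i\<^sub>j\<close> contributes \<open>y\<^sub>j - G\<^sub>j\<close> to coordinate \<open>i\<close>. Both terms have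
  weight \<open>q\<^sub>j\<close> in \<open>y\<close>, the second one by substitution, and this is the required weight \<open>w\<^sub>i\<close>.
\<close>

lemma homogeneous_function_chord_iterate:
  assumes graded: "graded_map w q G"
    and block: "\<And>i j. B $ i $ j \<noteq> 0 \<Longrightarrow> q $ j = w $ i"
  shows "homogeneous_function q (w $ i) (\<lambda>y. (chord_step B G y ^^ N) 0 $ i)"
proof (induction N arbitrary: i)
  case 0
  show ?case
    by (simp add: homogeneous_function_zero)
next
  case (Suc N)
  let ?h = "\<lambda>y. (chord_step B G y ^^ N) 0"
  have "homogeneous_function q (w $ i)
      (\<lambda>y. B $ i $ j * (y $ j - poly_eval (G $ j) (?h y)))" for j
  proof (cases "B $ i $ j = 0")
    case False
    then have "w $ i = q $ j"
      using block by simp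
    moreover have "weight_homogeneous w (q $ j) (G $ j)"
      using graded by (simp add: graded_map_def)
    ultimately show ?thesis
      by (auto intro!: homogeneous_function_cmult homogeneous_function_diff
          homogeneous_function_coordinate homogeneous_function_compose[where w = w] Suc)
  qed (simp add: homogeneous_function_zero)
  then show ?case
    unfolding funpow.simps o_apply chord_step_component
    by (intro homogeneous_function_add homogeneous_function_sum Suc)
qed

lemma graded_map_of_homogeneous_functions:
  assumes "\<And>i. homogeneous_function q (w $ i) (\<lambda>y. h y $ i)"
  obtains H where "graded_map q w H" and "h = poly_map H"
proof -
  obtain P where P: "\<And>i. weight_homogeneous q (w $ i) (P i) \<and> (\<lambda>y. h y $ i) = poly_eval (P i)"
    using assms unfolding homogeneous_function_def by metis
  then have "h y $ i = poly_eval (P i) y" for y i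
    by metis
  then show ?thesis
    using P by (intro that[of "\<chi> i. P i"])
      (auto simp: graded_map_def poly_map_def vec_eq_iff fun_eq_iff)
qed

section \<open>Graded Keller maps with elliptic source weights\<close>

theorem theorem3p1:
  fixes w q :: "int ^ 'n::finite"
    and G :: "('n cpoly) ^ 'n"
  assumes "elliptic w"
    and "keller_map G"
    and "graded_map w q G"
  shows "bij (poly_map G)
    \<and> (\<exists>H :: ('n cpoly) ^ 'n. inv (poly_map G) = poly_map H \<and> graded_map q w H)
    \<and> polynomial_automorphism (poly_map G)"
proof -
  obtain B where left: "B ** linear_part G = mat 1" and right: "linear_part G ** B = mat 1"
    and block: "\<And>i j. B $ i $ j \<noteq> 0 \<Longrightarrow> q $ j = w $ i"
    using graded_inverse_of_linear_part[OF assms(3) invertible_linear_part[OF assms(2)]] by blast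
  define N where "N = nat (\<Sum>i\<in>UNIV. \<bar>w $ i\<bar>)"
  have bound: "\<bar>w $ i\<bar> \<le> int N" for i
    unfolding N_def using member_le_sum[of i UNIV "\<lambda>i. \<bar>w $ i\<bar>"] by simp
  have const: "(chord_step B G y ^^ N) x = (chord_step B G y ^^ N) x'" for y x x'
    using chord_iterate_forgets_start[OF assms(1,3) left block bound]
    by (simp add: vec_eq_iff)
  define h where "h = (\<lambda>y. (chord_step B G y ^^ N) 0)"
  have preimage: "poly_map G x = y \<longleftrightarrow> x = h y" for x y
    unfolding h_def chord_step_fixed_point_iff[OF right, symmetric]
    by (rule fixed_point_iff_of_constant_iterate[OF const])
  have inverse: "h (poly_map G x) = x" "poly_map G (h y) = y" for x y
    using preimage by metis+
  then have bij: "bij (poly_map G)"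
    by (intro o_bij[of h]) (auto simp: fun_eq_iff)
  have inv: "inv (poly_map G) = h"
    using inverse by (intro inv_equality) auto
  have "homogeneous_function q (w $ i) (\<lambda>y. h y $ i)" for i
    unfolding h_def by (rule homogeneous_function_chord_iterate[OF assms(3) block])
  then obtain H where "graded_map q w H" "h = poly_map H"
    by (rule graded_map_of_homogeneous_functions)
  then show ?thesis
    using bij inv by (auto simp: polynomial_automorphism_def is_polynomial_map_def)
qed

end
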